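(* Let $m\in S(4,7)$ and $n\in S(3,7)$, with $m,n\ge 3$, and let $T_{m,n}=C_m\Box C_n$. Then $\chi(T_{m,n}^2)\le 7$.
   Context: For integers $r,s$, $S(r,s)=\{\alpha r+\beta s:\alpha,\beta \text{ nonnegative integers}\}$. $C_k$ denotes the cycle on $k$ vertices; $\Box$ is the Cartesian product of graphs ($(u_1,v_1)\sim(u_2,v_2)$ iff $u_1=u_2$ and $v_1v_2$ is an edge, or $v_1=v_2$ and $u_1u_2$ is an edge). The square $G^2$ of a graph $G$ has vertex set $V(G)$, two distinct vertices being adjacent iff their distance in $G$ is at most 2. $\chi$ is the chromatic number. *)

theory Defs
  imports "Graph_Theory.Graph_Theory" "HOL-Library.Extended_Nat"
begin

text \<open>
  Finite simple graphs are the \<^locale>\<open>pair_graph\<close>s of the library: loop-free symmetric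
  digraphs whose arcs are ordered pairs of vertices.
\<close>

definition S_set :: "int \<Rightarrow> int \<Rightarrow> int set" where
  "S_set r s = {int \<alpha> * r + int \<beta> * s | \<alpha> \<beta> :: nat. True}"

text \<open>Only meaningful for \<open>k \<ge> 3\<close>; below that the arcs degenerate to a loop or to a single edge.\<close>

definition cycle_graph :: "nat \<Rightarrow> nat pair_pre_digraph" where
  "cycle_graph k =
    \<lparr> pverts = {..<k},
      parcs = {(u, v). u < k \<and> v < k \<and> (v = (u + 1) mod k \<or> u = (v + 1) mod k)} \<rparr>"

definition cartesian_product ::
  "'a pair_pre_digraph \<Rightarrow> 'b pair_pre_digraph \<Rightarrow> ('a \<times> 'b) pair_pre_digraph"  (infixl \<open>\<box>\<close> 70) where
  "G \<box> H =
    \<lparr> pverts = pverts G \<times> pverts H,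
      parcs = {((u\<^sub>1, v\<^sub>1), (u\<^sub>2, v\<^sub>2)).
        (u\<^sub>1 \<in> pverts G \<and> u\<^sub>1 = u\<^sub>2 \<and> (v\<^sub>1, v\<^sub>2) \<in> parcs H) \<or>
        (v\<^sub>1 \<in> pverts H \<and> v\<^sub>1 = v\<^sub>2 \<and> (u\<^sub>1, u\<^sub>2) \<in> parcs G)} \<rparr>"

text \<open>
  The least cost of a walk under unit weights, that is, the least number of edges;
  it is \<open>\<infinity>\<close> if there is no walk.
\<close>

definition graph_dist :: "'a pair_pre_digraph \<Rightarrow> 'a \<Rightarrow> 'a \<Rightarrow> ereal" where
  "graph_dist G u v = wf_digraph.\<mu> (with_proj G) (\<lambda>_. 1) u v"

definition graph_square :: "'a pair_pre_digraph \<Rightarrow> 'a pair_pre_digraph" where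
  "graph_square G =
    \<lparr> pverts = pverts G,
      parcs = {(u, v). u \<in> pverts G \<and> v \<in> pverts G \<and> u \<noteq> v \<and> graph_dist G u v \<le> 2} \<rparr>"

definition proper_coloring :: "'a pair_pre_digraph \<Rightarrow> nat \<Rightarrow> ('a \<Rightarrow> nat) \<Rightarrow> bool" where
  "proper_coloring G k c \<longleftrightarrow>
    (\<forall>v \<in> pverts G. c v < k) \<and> (\<forall>(u, v) \<in> parcs G. c u \<noteq> c v)"

text \<open>The value is \<open>\<infinity>\<close> if the graph has no proper coloring with finitely many colors.\<close>

definition chromatic_number :: "'a pair_pre_digraph \<Rightarrow> enat" where
  "chromatic_number G = (INF k \<in> {k. \<exists>c. proper_coloring G k c}. enat k)"

definition torus_grid :: "nat \<Rightarrow> nat \<Rightarrow> (nat \<times> nat) pair_pre_digraph" where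
  "torus_grid m n = cycle_graph m \<box> cycle_graph n"

lemma pair_graph_cycle_graph:
  assumes "k \<ge> 3"
  shows "pair_graph (cycle_graph k)"
proof -
  have "parcs (cycle_graph k) \<subseteq> {..<k} \<times> {..<k}"
    by (auto simp: cycle_graph_def)
  then have fin: "finite (parcs (cycle_graph k))"
    by (rule finite_subset) simp
  have no_fix: "Suc u mod k \<noteq> u" if "u < k" for u
    using assms that by (cases "Suc u = k") auto
  show ?thesis
    using fin no_fix no_fix[symmetric]
    by unfold_locales (fastforce simp: cycle_graph_def symmetric_def sym_def)+
qed

lemma pair_graph_cartesian_product:
  assumes "pair_graph G" "pair_graph H"
  shows "pair_graph (G \<box> H)"
proof -
  interpret G: pair_graph G by fact
  interpret H: pair_graph H by fact
  have wf: "parcs (G \<box> H) \<subseteq> pverts (G \<box> H) \<times> pverts (G \<box> H)"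
    by (auto simp: cartesian_product_def dest: G.in_arcsD1 G.in_arcsD2 H.in_arcsD1 H.in_arcsD2)
  have finv: "finite (pverts (G \<box> H))"
    using G.pair_finite_verts H.pair_finite_verts by (simp add: cartesian_product_def)
  have fin: "finite (parcs (G \<box> H))"
    using wf by (rule finite_subset) (simp add: finv)
  have "sym (parcs G)" "sym (parcs H)"
    using G.pair_sym_arcs H.pair_sym_arcs by (simp_all add: symmetric_def)
  then have sym: "sym (parcs (G \<box> H))"
    by (auto simp: cartesian_product_def sym_def)
  show ?thesis
    using wf finv fin sym
    by unfold_locales
      (auto simp: symmetric_def cartesian_product_def
        dest: G.in_arcsD1 G.in_arcsD2 H.in_arcsD1 H.in_arcsD2 G.pair_no_loops H.pair_no_loops)
qed

lemma graph_dist_le_iff: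
  assumes "pair_wf_digraph G"
  shows "graph_dist G u v \<le> ereal (real k) \<longleftrightarrow>
    (\<exists>p. pre_digraph.awalk (with_proj G) u p v \<and> length p \<le> k)"
proof -
  interpret pair_wf_digraph G by fact
  have cost: "awalk_cost (\<lambda>_. 1) p = real (length p)" for p
    by (induction p) (auto simp: awalk_cost_def)
  have dist: "graph_dist G u v = (INF p \<in> {p. awalk u p v}. ereal (real (length p)))"
    by (simp add: graph_dist_def \<mu>_def cost)
  show ?thesis
  proof
    assume "graph_dist G u v \<le> ereal (real k)"
    also have "\<dots> < ereal (real k + 1)" by simp
    finally obtain p where "awalk u p v" "real (length p) < real k + 1"
      unfolding dist INF_less_iff by auto
    then show "\<exists>p. awalk u p v \<and> length p \<le> k"
      by (intro exI[of _ p]) auto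
  next
    assume "\<exists>p. awalk u p v \<and> length p \<le> k"
    then show "graph_dist G u v \<le> ereal (real k)"
      unfolding dist by (auto intro!: INF_lower2)
  qed
qed

end

theory Submission
  imports Defs
begin

text \<open>
  Cut the \<open>m\<close> rows into bands of height 4 and 7 and the \<open>n\<close> columns into bands of width 3 and 7.
  Fix one coloured block of each of the sizes \<open>4 \<times> 3\<close>, \<open>4 \<times> 7\<close>, \<open>7 \<times> 3\<close> and \<open>7 \<times> 7\<close> such that
  any two blocks placed next to each other, in either direction or diagonally, stay properly
  coloured. Walking once around a cycle, the position inside the current band moves along a fixed
  successor relation, so properness for all \<open>m\<close> and \<open>n\<close> is a finite condition on the four blocks.
\<close>

text \<open>
  The positions \<open>0, \<dots>, r - 1\<close> are those of a band of length \<open>r\<close>, the positions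
  \<open>r, \<dots>, r + s - 1\<close> those of a band of length \<open>s\<close>; after its last position either kind of
  band may follow.
\<close>

definition next_pos :: "nat \<Rightarrow> nat \<Rightarrow> nat \<Rightarrow> nat set" where
  "next_pos r s x = (if Suc x = r \<or> Suc x = r + s then {0, r} else {Suc x})"

text \<open>A closed walk of length \<open>k\<close> along \<open>next_pos\<close> exists because
  the cycle can be cut into \<alpha> bands of length \<open>r\<close> followed by \<beta> bands of
  length \<open>s\<close>.\<close>

lemma S_set_band_positions:
  assumes "int k \<in> S_set (int r) (int s)" "r > 0" "s > 0"
  obtains a where "\<And>i. a i < r + s"
    and "\<And>i. i < k \<Longrightarrow> a (Suc i mod k) \<in> next_pos r s (a i)"
proof -
  obtain \<alpha> \<beta> :: nat where "int k = int \<alpha> * int r + int \<beta> * int s"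
    using assms(1) by (auto simp: S_set_def)
  then have k: "k = \<alpha> * r + \<beta> * s"
    by (metis of_nat_add of_nat_eq_iff of_nat_mult)
  \<comment> \<open>The value is the offset inside the current band, shifted by \<open>r\<close> in
    the bands of length \<open>s\<close>. The formula stays below \<open>r + s\<close> even for
    \<open>i \<ge> k\<close>.\<close>
  define a where "a i = (if i < \<alpha> * r then i mod r else r + (i - \<alpha> * r) mod s)" for i
  have "a i < r + s" for i
    using assms(2,3) by (auto simp: a_def intro: trans_less_add1)
  moreover have "a (Suc i mod k) \<in> next_pos r s (a i)" if "i < k" for i
  proof -
    \<comment> \<open>Index 0 starts a band, of length \<open>s\<close> if \<alpha> = 0, so closing
      the cycle is again a legal transition.\<close>
    have wrap: "a 0 = 0 \<or> a 0 = r"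
      by (simp add: a_def)
    have r_end: "Suc (i mod r) = r" if "Suc i = \<alpha> * r"
      using that by (metis mod_Suc mod_mult_self2_is_0 nat.distinct(1))
    have s_end: "Suc ((i - \<alpha> * r) mod s) = s" if "Suc (i - \<alpha> * r) = \<beta> * s"
      using that by (metis mod_Suc mod_mult_self2_is_0 nat.distinct(1))
    show ?thesis
    proof (cases "i < \<alpha> * r")
      case True
      have lt: "i mod r < r" using assms(2) by simp
      consider "Suc i < \<alpha> * r" | "Suc i = \<alpha> * r" using True by linarith
      then show ?thesis
      proof cases
        case 1
        then have "Suc i mod k = Suc i" by (simp add: k)
        then show ?thesis using 1 True lt by (auto simp: a_def next_pos_def mod_Suc)
      next
        case 2
        \<comment> \<open>After the last band of length \<open>r\<close>, either the cycle closes
          (\<beta> = 0) or the first band of length \<open>s\<close> begins.\<close>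
        have "a (Suc i mod k) = 0 \<or> a (Suc i mod k) = r"
        proof (cases "Suc i = k")
          case True
          then show ?thesis using wrap by simp
        next
          case False
          then have "Suc i mod k = \<alpha> * r" using \<open>i < k\<close> 2 by simp
          then show ?thesis by (simp add: a_def)
        qed
        then show ?thesis using True r_end[OF 2] by (auto simp: a_def next_pos_def)
      qed
    next
      case False
      have lt: "(i - \<alpha> * r) mod s < s" using assms(3) by simp
      consider "Suc i < k" | "Suc i = k" using \<open>i < k\<close> by linarith
      then show ?thesis
      proof cases
        case 1
        then have "Suc i mod k = Suc i" by simp
        moreover have "Suc i - \<alpha> * r = Suc (i - \<alpha> * r)" using False by simp
        ultimately show ?thesis using 1 False lt by (auto simp: a_def next_pos_def mod_Suc)
      next
        case 2
        then have "Suc (i - \<alpha> * r) = \<beta> * s" using False k by simp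
        then show ?thesis using 2 False wrap s_end by (auto simp: a_def next_pos_def)
      qed
    qed
  qed
  ultimately show ?thesis by (rule that)
qed

text \<open>
  Rows 0--3 and 4--10 belong to bands of height 4 and 7, columns 0--2 and 3--9 to bands of
  width 3 and 7. The entries are the output of a SAT solver on the constraints in
  \<open>block_color_separates\<close>.
\<close>

definition block_color :: "nat \<Rightarrow> nat \<Rightarrow> nat" where
  "block_color x y =
    [[0, 1, 2, 0, 1, 4, 5, 0, 4, 2],
     [6, 3, 5, 6, 2, 3, 6, 1, 3, 5],
     [2, 0, 1, 3, 0, 5, 4, 2, 0, 4],
     [3, 6, 4, 5, 6, 2, 1, 3, 6, 1],
     [0, 1, 2, 0, 1, 4, 5, 0, 4, 2],
     [6, 3, 5, 4, 2, 3, 6, 1, 3, 5],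
     [1, 4, 0, 1, 6, 0, 2, 4, 6, 0],
     [2, 5, 6, 2, 4, 5, 1, 0, 5, 3],
     [4, 0, 3, 5, 0, 3, 4, 6, 2, 1],
     [5, 2, 1, 4, 2, 1, 0, 5, 3, 0],
     [3, 4, 6, 3, 5, 6, 3, 2, 1, 6]] ! x ! y"

lemma block_color_less: "x < 11 \<Longrightarrow> y < 10 \<Longrightarrow> block_color x y < 7"
proof -
  have "\<forall>x\<in>{..<11}. \<forall>y\<in>{..<10}. block_color x y < 7"
    by code_simp
  then show "x < 11 \<Longrightarrow> y < 10 \<Longrightarrow> block_color x y < 7" by simp
qed

text \<open>Up to swapping the endpoints, these are all displacements of length 1 or 2 in a grid:
  one or two steps along an axis, and both diagonals. There are finitely many positions, so
  evaluation decides the claim.\<close>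

lemma block_color_separates:
  assumes "x < 11" "y < 10"
    and "x1 \<in> next_pos 4 7 x" "x2 \<in> next_pos 4 7 x1"
    and "y1 \<in> next_pos 3 7 y" "y2 \<in> next_pos 3 7 y1"
  shows "block_color x y \<noteq> block_color x1 y" "block_color x y \<noteq> block_color x2 y"
    and "block_color x y \<noteq> block_color x y1" "block_color x y \<noteq> block_color x y2"
    and "block_color x y \<noteq> block_color x1 y1" "block_color x1 y \<noteq> block_color x y1"
proof -
  have "\<forall>x\<in>{..<11}. \<forall>y\<in>{..<10}.
    (\<forall>x1\<in>next_pos 4 7 x. block_color x y \<noteq> block_color x1 y \<and>
      (\<forall>x2\<in>next_pos 4 7 x1. block_color x y \<noteq> block_color x2 y) \<and>
      (\<forall>y1\<in>next_pos 3 7 y. block_color x y \<noteq> block_color x1 y1 \<and>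
        block_color x1 y \<noteq> block_color x y1)) \<and>
    (\<forall>y1\<in>next_pos 3 7 y. block_color x y \<noteq> block_color x y1 \<and>
      (\<forall>y2\<in>next_pos 3 7 y1. block_color x y \<noteq> block_color x y2))"
    by code_simp
  with assms show "block_color x y \<noteq> block_color x1 y" "block_color x y \<noteq> block_color x2 y"
    and "block_color x y \<noteq> block_color x y1" "block_color x y \<noteq> block_color x y2"
    and "block_color x y \<noteq> block_color x1 y1" "block_color x1 y \<noteq> block_color x y1"
    by blast+
qed

lemma parcs_graph_square_cases:
  assumes "pair_wf_digraph G" "(u, v) \<in> parcs (graph_square G)"
  obtains "(u, v) \<in> parcs G" "u \<noteq> v"
  | w where "(u, w) \<in> parcs G" "(w, v) \<in> parcs G" "u \<noteq> v"
proof -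
  interpret pair_wf_digraph G by fact
  have ne: "u \<noteq> v" and "graph_dist G u v \<le> ereal (real 2)"
    using assms(2) by (simp_all add: graph_square_def)
  then obtain p where p: "awalk u p v" "length p \<le> 2"
    using graph_dist_le_iff[OF assms(1)] by blast
  show ?thesis
  proof (cases p)
    case Nil
    then show ?thesis using p ne by (auto simp: awalk_def)
  next
    case (Cons e q)
    then show ?thesis
      using p ne that by (cases q; cases e) (auto simp: awalk_simps)
  qed
qed

text \<open>Needed for a walk that steps forward and then back along one cycle: it returns to its
  start.\<close>

lemma Suc_mod_inj:
  assumes "i < k" "j < k" "Suc i mod k = Suc j mod k"
  shows "i = j"
  using assms by (auto simp: mod_Suc split: if_splits)

lemma chromatic_number_le:
  "proper_coloring G k c \<Longrightarrow> chromatic_number G \<le> enat k"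
  unfolding chromatic_number_def by (auto intro: INF_lower)

lemma parcs_torus_grid:
  "((i, j), (i', j')) \<in> parcs (torus_grid m n) \<longleftrightarrow>
    i < m \<and> j < n \<and> i' < m \<and> j' < n \<and>
    (i' = i \<and> (j' = Suc j mod n \<or> j = Suc j' mod n) \<or>
     j' = j \<and> (i' = Suc i mod m \<or> i = Suc i' mod m))"
  by (auto simp: torus_grid_def cartesian_product_def cycle_graph_def)

theorem theorem4:
  fixes m n :: nat
  assumes "int m \<in> S_set 4 7" and "int n \<in> S_set 3 7"
    and "m \<ge> 3" and "n \<ge> 3"
  shows "chromatic_number (graph_square (torus_grid m n)) \<le> 7"
proof -
  obtain a where a_less: "\<And>i. a i < 11"
    and a_next: "\<And>i. i < m \<Longrightarrow> a (Suc i mod m) \<in> next_pos 4 7 (a i)"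
    using S_set_band_positions[of m 4 7] assms(1) by auto
  obtain b where b_less: "\<And>j. b j < 10"
    and b_next: "\<And>j. j < n \<Longrightarrow> b (Suc j mod n) \<in> next_pos 3 7 (b j)"
    using S_set_band_positions[of n 3 7] assms(2) by auto
  define c where "c = (\<lambda>(i, j). block_color (a i) (b j))"
  have c_ne: "c (i, j) \<noteq> c (Suc i mod m, j)" "c (i, j) \<noteq> c (Suc (Suc i mod m) mod m, j)"
    "c (i, j) \<noteq> c (i, Suc j mod n)" "c (i, j) \<noteq> c (i, Suc (Suc j mod n) mod n)"
    "c (i, j) \<noteq> c (Suc i mod m, Suc j mod n)" "c (Suc i mod m, j) \<noteq> c (i, Suc j mod n)"
    if "i < m" "j < n" for i j
  proof -
    have "Suc i mod m < m" "Suc j mod n < n" using that by simp_all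
    note sep = block_color_separates[OF a_less b_less a_next[OF that(1)] a_next[OF this(1)]
        b_next[OF that(2)] b_next[OF this(2)]]
    show "c (i, j) \<noteq> c (Suc i mod m, j)" "c (i, j) \<noteq> c (Suc (Suc i mod m) mod m, j)"
      "c (i, j) \<noteq> c (i, Suc j mod n)" "c (i, j) \<noteq> c (i, Suc (Suc j mod n) mod n)"
      "c (i, j) \<noteq> c (Suc i mod m, Suc j mod n)" "c (Suc i mod m, j) \<noteq> c (i, Suc j mod n)"
      using sep by (simp_all add: c_def)
  qed
  have wf: "pair_wf_digraph (torus_grid m n)"
  proof -
    interpret pair_graph "torus_grid m n"
      unfolding torus_grid_def
      using assms(3,4) by (intro pair_graph_cartesian_product pair_graph_cycle_graph)
    show ?thesis by unfold_locales
  qed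
  have "c u \<noteq> c v" if "(u, v) \<in> parcs (graph_square (torus_grid m n))" for u v
  proof -
    obtain i j i' j' where uv: "u = (i, j)" "v = (i', j')" by fastforce
    from wf that show ?thesis
    proof (cases rule: parcs_graph_square_cases)
      case 1
      then show ?thesis
        unfolding uv parcs_torus_grid using c_ne by metis
    next
      case (2 w)
      obtain k l where w: "w = (k, l)" by fastforce
      show ?thesis
        using 2 unfolding uv w parcs_torus_grid
        \<comment> \<open>Each arc has four directions, giving 16 cases. Opposite steps would force
          \<open>u = v\<close>; equal steps are a displacement by two along an axis; steps along
          different axes are a diagonal, with \<open>c_ne\<close> taken at the lower corner of the
          unit square.\<close>
        by (elim conjE disjE) (simp; metis c_ne Suc_mod_inj)+
    qed
  qed
  moreover have "c u < 7" for u
    by (cases u) (simp add: c_def a_less b_less block_color_less)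
  ultimately have "proper_coloring (graph_square (torus_grid m n)) 7 c"
    by (auto simp: proper_coloring_def)
  then show ?thesis
    using chromatic_number_le by (fastforce simp: numeral_eq_enat)
qed

end
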